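(* Let $n\ge1$ and let $\mathbf{m}=(m_1,\dots,m_n)$, $\mathbf{r}=(r_1,\dots,r_n)$ be vectors of positive integers, and let $m=m_1+\cdots+m_n$. Suppose that $r_j\ge m_j+1$ for all $j\in\{1,\dots,n\}$. Then $$\mathcal{I}_m A_{\mathbf{m}}^{\mathbf{r}}\prec A_{\mathbf{m}}^{\mathbf{r}}.$$
   Context: A colored multiset permutation in $\mathfrak{S}_{\mathbf{m}}^{\mathbf{r}}$ is a word $\pi^{\mathbf{c}}=\pi_1^{c_1}\cdots\pi_m^{c_m}$ in which each $k\in\{1,\dots,n\}$ appears exactly $m_k$ times among $\pi_1,\dots,\pi_m$, and $1\le c_j\le r_{\pi_j}$ for all $j\in\{1,\dots,m\}$. One always appends $\pi_{m+1}^{c_{m+1}}:=(n+1)^1$. Colored letters are totally ordered by $k^{c}<l^{c'}$ iff $c<c'$, or $c=c'$ and $k<l$. A descent of $\pi^{\mathbf{c}}$ is an index $j\in\{1,\dots,m\}$ with $\pi_j^{c_j}>\pi_{j+1}^{c_{j+1}}$, and $\mathrm{des}(\pi^{\mathbf{c}})$ is the number of descents. The colored multiset Eulerian polynomial is $A_{\mathbf{m}}^{\mathbf{r}}=\sum_{\pi^{\mathbf{c}}\in\mathfrak{S}_{\mathbf{m}}^{\mathbf{r}}}x^{\mathrm{des}(\pi^{\mathbf{c}})}$. For a polynomial $p$ of degree at most $d$, its reciprocal with respect to degree $d$ is $\mathcal{I}_d(p)=x^dp(1/x)$; $\mathcal{I}_m A_{\mathbf{m}}^{\mathbf{r}}$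 denotes $\mathcal{I}_m(A_{\mathbf{m}}^{\mathbf{r}})$. Given two real-rooted polynomials $p$ and $q$ with respective zeros $\alpha_1\ge\alpha_2\ge\cdots$ and $\beta_1\ge\beta_2\ge\cdots$, one says that $p$ is interlaced by $q$, written $q\preceq p$, if $\alpha_1\ge\beta_1\ge\alpha_2\ge\beta_2\ge\cdots$. When these inequalities are strict, one writes $q\prec p$ instead.
   Formalization: Strict interlacing is claimed only if some r_j ≠ m_j+1; if all r_j = m_j+1, then I_m A = A (e.g. n=1, m_1=1, r_1=2: A=1+x) and strictness fails, so only weak interlacing and simplicity of the zeros of A are stated there. *)

theory Defs
  imports "HOL-Computational_Algebra.Computational_Algebra"
begin

section \<open>Colored multiset permutations\<close>

text \<open>The colored letter written as \<open>k\<close> with superscript \<open>c\<close> is the pair \<open>(k, c)\<close>.\<close>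

type_synonym letter = "nat \<times> nat"

text \<open>The color is compared first.\<close>

definition letter_less :: "letter \<Rightarrow> letter \<Rightarrow> bool" where
  "letter_less a b \<longleftrightarrow> snd a < snd b \<or> (snd a = snd b \<and> fst a < fst b)"

text \<open>The vectors are functions of which only the values at \<open>1, \<dots>, n\<close> matter.\<close>

definition colored_multiset_perms ::
    "nat \<Rightarrow> (nat \<Rightarrow> nat) \<Rightarrow> (nat \<Rightarrow> nat) \<Rightarrow> letter list set" where
  "colored_multiset_perms n m r =
     {w. length w = (\<Sum>k=1..n. m k) \<and>
         (\<forall>k\<in>{1..n}. count_list (map fst w) k = m k) \<and>
         (\<forall>(k, c)\<in>set w. k \<in> {1..n} \<and> 1 \<le> c \<and> c \<le> r k)}"

text \<open>Positions are counted from \<open>0\<close>; the appended letter \<open>(n + 1, 1)\<close> has position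
  \<open>length w\<close>.\<close>

definition des :: "nat \<Rightarrow> letter list \<Rightarrow> nat" where
  "des n w = (let w' = w @ [(n + 1, 1)]
              in card {j. j < length w \<and> letter_less (w' ! Suc j) (w' ! j)})"

definition eulerian_poly :: "nat \<Rightarrow> (nat \<Rightarrow> nat) \<Rightarrow> (nat \<Rightarrow> nat) \<Rightarrow> real poly" where
  "eulerian_poly n m r = (\<Sum>w\<in>colored_multiset_perms n m r. monom 1 (des n w))"

lemma finite_colored_multiset_perms: "finite (colored_multiset_perms n m r)"
proof (rule finite_subset)
  let ?L = "SIGMA k:{1..n}. {1..r k}"
  show "colored_multiset_perms n m r \<subseteq> {w. set w \<subseteq> ?L \<and> length w = (\<Sum>k=1..n. m k)}"
    by (auto simp: colored_multiset_perms_def)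
  show "finite {w. set w \<subseteq> ?L \<and> length w = (\<Sum>k=1..n. m k)}"
    by (rule finite_lists_length_eq) auto
qed


section \<open>Reciprocals and interlacing\<close>

text \<open>Intended for \<open>degree p \<le> d\<close>; the degree may be smaller than \<open>d\<close>, so this is not
  \<^const>\<open>reflect_poly\<close>.\<close>

definition reciprocal :: "nat \<Rightarrow> 'a::comm_semiring_1 poly \<Rightarrow> 'a poly" where
  "reciprocal d p = (\<Sum>i\<le>d. monom (coeff p i) (d - i))"

lemma poly_reciprocal:
  fixes p :: "'a::field poly"
  assumes "degree p \<le> d" and "x \<noteq> 0"
  shows "poly (reciprocal d p) x = x ^ d * poly p (1 / x)"
proof -
  have "poly p (1 / x) = (\<Sum>i\<le>d. coeff p i * (1 / x) ^ i)"
    unfolding poly_altdef using assms(1)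
    by (intro sum.mono_neutral_left) (auto simp: coeff_eq_0)
  then show ?thesis
    using assms(2)
    by (simp add: reciprocal_def poly_sum poly_monom sum_distrib_left power_diff
        power_one_over divide_simps mult_ac)
qed

definition real_rooted :: "real poly \<Rightarrow> bool" where
  "real_rooted p \<longleftrightarrow> (\<forall>z::complex. poly (map_poly complex_of_real p) z = 0 \<longrightarrow> z \<in> \<real>)"

text \<open>The real zeros, repeated according to multiplicity, in weakly decreasing order.\<close>

definition zeros_desc :: "real poly \<Rightarrow> real list" where
  "zeros_desc p = rev (sorted_list_of_multiset (proots p))"

text \<open>
  \<open>alternating R as bs\<close> is the chain \<open>R a\<^sub>1 b\<^sub>1\<close>, \<open>R b\<^sub>1 a\<^sub>2\<close>, \<open>R a\<^sub>2 b\<^sub>2\<close>, \<open>\<dots>\<close>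
  through all entries of both lists; so \<open>as\<close> is as long as \<open>bs\<close> or longer by one.
\<close>

definition alternating :: "(real \<Rightarrow> real \<Rightarrow> bool) \<Rightarrow> real list \<Rightarrow> real list \<Rightarrow> bool" where
  "alternating R as bs \<longleftrightarrow>
     length bs \<le> length as \<and> length as \<le> Suc (length bs) \<and>
     (\<forall>i<length bs. R (as ! i) (bs ! i)) \<and>
     (\<forall>i. Suc i < length as \<longrightarrow> R (bs ! i) (as ! Suc i))"

text \<open>The interlacing polynomial comes first, the one with the largest zero second.\<close>

definition interlaces :: "real poly \<Rightarrow> real poly \<Rightarrow> bool" (infix "\<preceq>\<^sub>i" 50) where
  "q \<preceq>\<^sub>i p \<longleftrightarrow> real_rooted p \<and> real_rooted q \<and>
     alternating (\<ge>) (zeros_desc p) (zeros_desc q)"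

text \<open>All inequalities are strict, so there are no common zeros, and no nonconstant polynomial
  strictly interlaces itself.\<close>

definition strictly_interlaces :: "real poly \<Rightarrow> real poly \<Rightarrow> bool" (infix "\<prec>\<^sub>i" 50) where
  "q \<prec>\<^sub>i p \<longleftrightarrow> real_rooted p \<and> real_rooted q \<and>
     alternating (>) (zeros_desc p) (zeros_desc q)"

end

theory Submission
  imports Defs "HOL-Library.Product_Lexorder" "HOL-Library.Disjoint_Sets"
begin

text \<open>
  Words with bars: inserting \<open>t\<close> dividers into a colored multiset permutation, at least one at every
  descent, amounts to choosing for each \<open>k\<close> a multiset of size \<open>m\<^sub>k\<close> from \<open>r\<^sub>k t + 1\<close> elements. Hence
  \<open>A / (1 - x)\<^bsup>m+1\<^esup>\<close> is the generating function of \<open>\<Prod>\<^sub>k (r\<^sub>k t + m\<^sub>k choose m\<^sub>k)\<close>, which is up to a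
  positive constant a product of factors \<open>t + a\<close> with shifts \<open>a = i / r\<^sub>k \<in> (0, 1)\<close>.

  Multiplying the coefficients by \<open>t + a\<close> acts on numerators \<open>p\<close> by a differential operator whose
  values have zeros separated by those of \<open>p\<close>. So all zeros are real, negative and simple, and each
  zero strictly decreases when one shift increases. Taking the reciprocal replaces every \<open>a\<close> by
  \<open>1 - a\<close>; since \<open>r\<^sub>k \<ge> m\<^sub>k + 1\<close>, after reordering this increases the shifts weakly, which gives one half of the
  interlacing. For the other half, the zeros are compared with those of the numerator with all shifts
  equal to \<open>1\<close>, whose coefficients are palindromic.
\<close>

section \<open>Polynomials with simple negative zeros\<close>

text \<open>The zeros are numbered from the largest down. There are as many distinct zeros as the
  degree, so all are simple; the sign of the leading coefficient then fixes every sign of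
  \<open>p\<close> on the line.\<close>

definition neg_zeros :: "nat \<Rightarrow> real poly \<Rightarrow> (nat \<Rightarrow> real) \<Rightarrow> bool" where
  "neg_zeros d p \<rho> \<longleftrightarrow> degree p = d \<and> lead_coeff p > 0 \<and>
     (\<forall>i<d. poly p (\<rho> i) = 0 \<and> \<rho> i < 0) \<and> (\<forall>i j. i < j \<longrightarrow> j < d \<longrightarrow> \<rho> j < \<rho> i)"

text \<open>Both sides agree at \<open>d\<close> distinct points and in the coefficient at
  \<open>d\<close>. That coefficient replaces the leading one, so that the exact degree need not be
  known beforehand.\<close>

lemma eq_prod_linear_factors:
  fixes p :: "real poly"
  assumes "degree p \<le> d" and "\<And>i. i < d \<Longrightarrow> poly p (\<rho> i) = 0" and "inj_on \<rho> {..<d}"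
  shows "p = smult (coeff p d) (\<Prod>i<d. [:- \<rho> i, 1:])" (is "_ = ?q")
proof (rule poly_eqI_degree_lead_coeff[where n = d and A = "\<rho> ` {..<d}"])
  have deg: "degree (\<Prod>i<d. [:- \<rho> i, 1:]) = d"
    by (subst degree_prod_sum_eq) auto
  then show "degree ?q \<le> d"
    using degree_smult_le[of "coeff p d" "\<Prod>i<d. [:- \<rho> i, 1:]"] by simp
  have "lead_coeff (\<Prod>i<d. [:- \<rho> i, 1:]) = 1"
    by (simp add: lead_coeff_prod)
  then show "coeff p d = coeff ?q d"
    using deg by simp
  show "d \<le> card (\<rho> ` {..<d})"
    using assms(3) by (simp add: card_image)
qed (use assms in \<open>auto simp: poly_prod\<close>)

lemma neg_zerosD:
  assumes "neg_zeros d p \<rho>"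
  shows "degree p = d" and "0 < lead_coeff p" and "i < d \<Longrightarrow> poly p (\<rho> i) = 0"
    and "i < d \<Longrightarrow> \<rho> i < 0" and "i < j \<Longrightarrow> j < d \<Longrightarrow> \<rho> j < \<rho> i"
  using assms unfolding neg_zeros_def by blast+

lemma neg_zeros_inj: "neg_zeros d p \<rho> \<Longrightarrow> inj_on \<rho> {..<d}"
  by (rule linorder_inj_onI') (force simp: neg_zeros_def)

lemma neg_zeros_factor:
  assumes "neg_zeros d p \<rho>"
  shows "p = smult (lead_coeff p) (\<Prod>i<d. [:- \<rho> i, 1:])"
  using eq_prod_linear_factors[of p d \<rho>] neg_zeros_inj[OF assms] assms
  by (auto simp: neg_zeros_def)

text \<open>Exactly the \<open>k\<close> factors \<open>y - \<rho> i\<close> with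
  \<open>i < k\<close> are negative.\<close>

lemma neg_zeros_sign:
  assumes "neg_zeros d p \<rho>" and "k \<le> d"
    and "\<And>i. i < k \<Longrightarrow> y < \<rho> i" and "\<And>i. k \<le> i \<Longrightarrow> i < d \<Longrightarrow> \<rho> i < y"
  shows "0 < (-1) ^ k * poly p y"
proof -
  have "{..<d} = {..<k} \<union> {k..<d}" "{..<k} \<inter> {k..<d} = {}"
    using assms(2) by auto
  then have "(\<Prod>i<d. y - \<rho> i) = (\<Prod>i<k. y - \<rho> i) * (\<Prod>i=k..<d. y - \<rho> i)"
    by (simp add: prod.union_disjoint)
  moreover have "(\<Prod>i<k. y - \<rho> i) = (-1) ^ k * (\<Prod>i<k. \<rho> i - y)"
    using prod_uminus[of "\<lambda>i. \<rho> i - y" "{..<k}"] by simp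
  moreover have "poly p y = lead_coeff p * (\<Prod>i<d. y - \<rho> i)"
    by (subst neg_zeros_factor[OF assms(1)]) (simp add: poly_prod)
  ultimately have "(-1) ^ k * poly p y =
      lead_coeff p * (\<Prod>i<k. \<rho> i - y) * (\<Prod>i=k..<d. y - \<rho> i)"
    by (simp add: mult_ac flip: power_mult_distrib)
  moreover have "0 < (\<Prod>i<k. \<rho> i - y)" "0 < (\<Prod>i=k..<d. y - \<rho> i)"
    using assms(3,4) by (auto intro!: prod_pos)
  ultimately show ?thesis
    using assms(1) by (auto simp: neg_zeros_def)
qed

lemma neg_zeros_pos_at_0: "neg_zeros d p \<rho> \<Longrightarrow> 0 < poly p 0"
  using neg_zeros_sign[of d p \<rho> 0 0] by (auto simp: neg_zeros_def)

text \<open>At a simple zero the derivative is the product of the other factors, and the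
  \<open>i\<close> larger zeros make \<open>i\<close> of these negative.\<close>

lemma neg_zeros_pderiv_sign:
  assumes "neg_zeros d p \<rho>" and "i < d"
  shows "0 < (-1) ^ i * poly (pderiv p) (\<rho> i)"
proof -
  let ?Q = "\<Prod>j\<in>{..<d} - {i}. [:- \<rho> j, 1:]"
  have "p = smult (lead_coeff p) ([:- \<rho> i, 1:] * ?Q)"
    using neg_zeros_factor[OF assms(1)] assms(2) by (simp add: prod.remove)
  then have "poly (pderiv p) (\<rho> i) =
      poly (pderiv (smult (lead_coeff p) ([:- \<rho> i, 1:] * ?Q))) (\<rho> i)"
    by simp
  also have "\<dots> = lead_coeff p * (\<Prod>j\<in>{..<d} - {i}. \<rho> i - \<rho> j)"
    by (simp add: pderiv_smult pderiv_mult pderiv_pCons poly_prod del: mult_pCons_left)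
  finally have eq: "poly (pderiv p) (\<rho> i) = lead_coeff p * (\<Prod>j\<in>{..<d} - {i}. \<rho> i - \<rho> j)" .
  have "{..<d} - {i} = {..<i} \<union> {i<..<d}" "{..<i} \<inter> {i<..<d} = {}"
    using assms(2) by auto
  then have "(\<Prod>j\<in>{..<d} - {i}. \<rho> i - \<rho> j) =
      (\<Prod>j<i. \<rho> i - \<rho> j) * (\<Prod>j\<in>{i<..<d}. \<rho> i - \<rho> j)"
    by (simp add: prod.union_disjoint)
  moreover have "(\<Prod>j<i. \<rho> i - \<rho> j) = (-1) ^ i * (\<Prod>j<i. \<rho> j - \<rho> i)"
    using prod_uminus[of "\<lambda>j. \<rho> j - \<rho> i" "{..<i}"] by simp
  ultimately have "(-1) ^ i * poly (pderiv p) (\<rho> i) =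
      lead_coeff p * (\<Prod>j<i. \<rho> j - \<rho> i) * (\<Prod>j\<in>{i<..<d}. \<rho> i - \<rho> j)"
    by (simp add: eq mult_ac flip: power_mult_distrib)
  moreover have "0 < (\<Prod>j<i. \<rho> j - \<rho> i)" "0 < (\<Prod>j\<in>{i<..<d}. \<rho> i - \<rho> j)"
    using assms by (auto intro!: prod_pos simp: neg_zeros_def)
  ultimately show ?thesis
    using assms(1) by (auto simp: neg_zeros_def)
qed

text \<open>The intermediate value theorem gives one zero in each of \<open>d\<close> disjoint
  intervals, which exhausts the degree. Positivity at \<open>0\<close> then forces degree exactly
  \<open>d\<close> and a positive leading coefficient.\<close>

lemma neg_zeros_exist:
  assumes "degree p \<le> d" and "0 < poly p 0"
    and "\<And>i. i < d \<Longrightarrow> lo i < hi i" and "\<And>i. i < d \<Longrightarrow> hi i \<le> 0"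
    and "\<And>i. i < d \<Longrightarrow> 0 < (-1) ^ i * poly p (hi i)"
    and "\<And>i. i < d \<Longrightarrow> (-1) ^ i * poly p (lo i) < 0"
    and "\<And>i j. i < j \<Longrightarrow> j < d \<Longrightarrow> hi j \<le> lo i"
  obtains \<alpha> where "neg_zeros d p \<alpha>" and "\<And>i. i < d \<Longrightarrow> lo i < \<alpha> i \<and> \<alpha> i < hi i"
proof -
  have "\<forall>i\<in>{..<d}. \<exists>x. lo i < x \<and> x < hi i \<and> poly p x = 0"
  proof
    fix i assume "i \<in> {..<d}"
    then have i: "i < d" by simp
    have "(-1) ^ i * poly p (lo i) * ((-1) ^ i * poly p (hi i)) < 0"
      using assms(5,6)[OF i] by (rule mult_neg_pos[rotated])
    then have "poly p (lo i) * poly p (hi i) < 0"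
      by (simp add: mult_ac flip: power_mult_distrib)
    then show "\<exists>x. lo i < x \<and> x < hi i \<and> poly p x = 0"
      using poly_IVT[OF assms(3)[OF i]] by auto
  qed
  then obtain \<alpha> where \<alpha>: "\<And>i. i < d \<Longrightarrow> lo i < \<alpha> i \<and> \<alpha> i < hi i \<and> poly p (\<alpha> i) = 0"
    by (metis bchoice lessThan_iff)
  have desc: "\<alpha> j < \<alpha> i" if "i < j" "j < d" for i j
    using \<alpha>[of i] \<alpha>[of j] assms(7)[OF that] that by linarith
  have neg: "\<alpha> i < 0" if "i < d" for i
    using \<alpha>[OF that] assms(4)[OF that] by linarith
  have inj: "inj_on \<alpha> {..<d}"
    by (rule linorder_inj_onI') (force dest: desc)
  have p: "p = smult (coeff p d) (\<Prod>i<d. [:- \<alpha> i, 1:])"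
    by (rule eq_prod_linear_factors) (use assms(1) \<alpha> inj in auto)
  have "poly p 0 = coeff p d * (\<Prod>i<d. - \<alpha> i)"
    by (subst p) (simp add: poly_prod)
  moreover have "0 < (\<Prod>i<d. - \<alpha> i)"
    using neg by (intro prod_pos) auto
  ultimately have "0 < coeff p d"
    using assms(2) by (simp add: zero_less_mult_iff)
  moreover have "degree p = d"
    using calculation assms(1) by (intro antisym le_degree) auto
  ultimately have "neg_zeros d p \<alpha>"
    unfolding neg_zeros_def using \<alpha> neg desc by auto
  with \<alpha> show ?thesis
    using that by blast
qed

lemma sign_at_minus_infinity:
  fixes p :: "real poly"
  assumes "lead_coeff p > 0"
  obtains y where "y < M" and "0 < (-1) ^ degree p * poly p y"
proof -
  \<comment> \<open>Reflecting \<open>x\<close> to \<open>-x\<close> and correcting the sign makes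
    the leading coefficient positive, so that growth at plus infinity applies.\<close>
  let ?q = "smult ((-1) ^ degree p) (pcompose p [:0, -1:])"
  have "lead_coeff ?q = lead_coeff p"
    by (simp add: lead_coeff_comp flip: power_mult_distrib)
  then obtain N where N: "\<And>x. N \<le> x \<Longrightarrow> lead_coeff p \<le> poly ?q x"
    using poly_pinfty_gt_lc[of ?q] assms by metis
  let ?x = "max N (1 - M)"
  have "0 < (-1) ^ degree p * poly p (- ?x)"
    using N[of ?x] assms by (simp add: poly_pcompose)
  then show ?thesis
    using that[of "- ?x"] by simp
qed

section \<open>Lists of zeros, real-rootedness and simplicity\<close>

lemma zeros_desc_neg_zeros:
  assumes "neg_zeros d p \<rho>"
  shows "zeros_desc p = map \<rho> [0..<d]"
proof -
  have "p \<noteq> 0"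
    using assms by (auto simp: neg_zeros_def)
  have "proots p = (\<Sum>i<d. {#\<rho> i#})"
    using assms by (subst neg_zeros_factor[OF assms], subst proots_smult)
      (auto simp: neg_zeros_def proots_prod)
  also have "\<dots> = mset (map \<rho> [0..<d])"
    by (induction d) auto
  finally have "proots p = mset (rev (map \<rho> [0..<d]))"
    by simp
  moreover have "sorted (rev (map \<rho> [0..<d]))"
    unfolding sorted_wrt_rev sorted_wrt_map
    using assms by (auto simp: neg_zeros_def sorted_wrt_iff_nth_less intro!: less_imp_le)
  ultimately show ?thesis
    by (simp only: zeros_desc_def sorted_list_of_multiset_mset sorted_sort_id rev_rev_ident)
qed

text \<open>The decreasing list of zeros is determined by \<open>p\<close> alone.\<close>

lemma neg_zeros_unique:
  assumes "neg_zeros d p \<rho>" and "neg_zeros d p \<sigma>" and "i < d"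
  shows "\<rho> i = \<sigma> i"
  using zeros_desc_neg_zeros[OF assms(1)] zeros_desc_neg_zeros[OF assms(2)] assms(3) by simp

lemma map_poly_of_real_mult:
  "map_poly complex_of_real (p * q) = map_poly of_real p * map_poly of_real q"
  by (rule poly_eqI) (simp add: coeff_map_poly coeff_mult)

lemma real_rooted_neg_zeros:
  assumes "neg_zeros d p \<rho>"
  shows "real_rooted p"
proof -
  let ?f = "map_poly complex_of_real"
  have prod: "?f (\<Prod>i<k. [:- \<rho> i, 1:]) = (\<Prod>i<k. [:- of_real (\<rho> i), 1:])" for k
    by (induction k) (simp_all add: map_poly_of_real_mult map_poly_pCons del: mult_pCons_left mult_pCons_right)
  have "?f p = ?f ([:lead_coeff p:] * (\<Prod>i<d. [:- \<rho> i, 1:]))"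
    using neg_zeros_factor[OF assms] by simp
  also have "\<dots> = [:of_real (lead_coeff p):] * (\<Prod>i<d. [:- of_real (\<rho> i), 1:])"
    by (simp only: map_poly_of_real_mult prod) (simp add: map_poly_pCons)
  finally have eq: "?f p = [:of_real (lead_coeff p):] * (\<Prod>i<d. [:- of_real (\<rho> i), 1:])" .
  have lc: "lead_coeff p \<noteq> 0"
    using assms by (auto simp: neg_zeros_def)
  show ?thesis
    unfolding real_rooted_def
  proof (intro allI impI)
    fix z :: complex
    assume "poly (?f p) z = 0"
    then have "\<exists>i<d. z = of_real (\<rho> i)"
      using lc unfolding eq by (auto simp: poly_prod)
    then show "z \<in> \<real>"
      by auto
  qed
qed

lemma rsquarefree_neg_zeros:
  assumes "neg_zeros d p \<rho>"
  shows "rsquarefree p"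
  unfolding rsquarefree_roots
proof (intro allI notI)
  fix x
  assume x: "poly p x = 0 \<and> poly (pderiv p) x = 0"
  have "poly p x = lead_coeff p * (\<Prod>i<d. x - \<rho> i)"
    by (subst neg_zeros_factor[OF assms]) (simp add: poly_prod)
  then obtain i where "i < d" "x = \<rho> i"
    using x assms by (auto simp: neg_zeros_def)
  then show False
    using neg_zeros_pderiv_sign[OF assms, of i] x by simp
qed

lemma neg_zeros_smult:
  assumes "neg_zeros d p \<rho>" and "c > 0"
  shows "neg_zeros d (smult c p) \<rho>"
  using assms by (auto simp: neg_zeros_def)

section \<open>Coefficients and zeros of reciprocals\<close>

lemma degree_reciprocal_le: "degree (reciprocal d p) \<le> d"
  unfolding reciprocal_def by (rule degree_sum_le) (auto intro: order_trans[OF degree_monom_le])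

lemma coeff_reciprocal:
  "coeff (reciprocal d p) i = (if i \<le> d then coeff p (d - i) else 0)"
proof -
  have "coeff (reciprocal d p) i = (\<Sum>j\<le>d. if j = d - i \<and> i \<le> d then coeff p j else 0)"
    unfolding reciprocal_def coeff_sum by (intro sum.cong) (auto simp: coeff_monom)
  also have "\<dots> = (if i \<le> d then coeff p (d - i) else 0)"
    by (cases "i \<le> d") (simp_all add: sum.delta)
  finally show ?thesis .
qed

text \<open>Inversion is decreasing on the negative numbers, hence the reversed index. The new
  leading coefficient is \<open>poly p 0\<close>, which is positive.\<close>

lemma neg_zeros_reciprocal:
  assumes "neg_zeros d p \<rho>"
  shows "neg_zeros d (reciprocal d p) (\<lambda>i. 1 / \<rho> (d - 1 - i))"
proof -
  have coeff: "coeff (reciprocal d p) d = poly p 0"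
    by (simp add: coeff_reciprocal poly_0_coeff_0)
  then have pos: "0 < coeff (reciprocal d p) d"
    using neg_zeros_pos_at_0[OF assms] by simp
  then have deg: "degree (reciprocal d p) = d"
    using degree_reciprocal_le[of d p] by (intro antisym le_degree) auto
  have neg: "\<rho> i < 0" if "i < d" for i
    using assms that by (simp add: neg_zeros_def)
  have "poly (reciprocal d p) (1 / \<rho> (d - 1 - i)) = 0" if "i < d" for i
  proof -
    have "d - 1 - i < d"
      using that by simp
    then have "\<rho> (d - 1 - i) \<noteq> 0" "poly p (\<rho> (d - 1 - i)) = 0" "degree p \<le> d"
      using assms neg[of "d - 1 - i"] unfolding neg_zeros_def by auto
    then show ?thesis
      by (subst poly_reciprocal) auto
  qed
  moreover have "1 / \<rho> (d - 1 - j) < 1 / \<rho> (d - 1 - i)" if "i < j" "j < d" for i j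
  proof -
    have "d - 1 - j < d - 1 - i" "d - 1 - i < d"
      using that by auto
    then have "\<rho> (d - 1 - i) < \<rho> (d - 1 - j)" "\<rho> (d - 1 - j) < 0"
      using assms neg[of "d - 1 - j"] unfolding neg_zeros_def by auto
    then show ?thesis
      by (simp add: divide_simps)
  qed
  ultimately show ?thesis
    unfolding neg_zeros_def using pos deg neg by simp
qed

section \<open>Numerators of products of shifted factors\<close>

text \<open>If \<open>p / (1 - x)^(s+1)\<close> generates \<open>f t\<close>, then this polynomial
  over \<open>(1 - x)^(s+2)\<close> generates \<open>(t + a) * f t\<close>.\<close>

definition euler_step :: "nat \<Rightarrow> real \<Rightarrow> real poly \<Rightarrow> real poly" where
  "euler_step s a p = [:0, 1, -1:] * pderiv p + [:a, real s + 1 - a:] * p"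

text \<open>For shifts all equal to \<open>1\<close> these are the classical Eulerian
  polynomials.\<close>

fun euler :: "real list \<Rightarrow> real poly" where
  "euler [] = 1"
| "euler (a # as) = euler_step (length as) a (euler as)"

text \<open>The operator \<open>x d/dx\<close> multiplies the coefficient at \<open>t\<close> by
  \<open>t\<close>; it is applied to the series written as numerator over a power of
  \<open>1 - x\<close>.\<close>

lemma fps_euler:
  "Abs_fps (\<lambda>t. \<Prod>a\<leftarrow>as. real t + a) * (1 - fps_X) ^ Suc (length as) = fps_of_poly (euler as)"
proof (induction as)
  case Nil
  have "Abs_fps (\<lambda>t. 1) * (1 - fps_X) = (1 :: real fps)"
    by (rule fps_ext) (simp add: algebra_simps)
  then show ?case
    by simp
next
  case (Cons a as)
  define F where "F = Abs_fps (\<lambda>t. \<Prod>a\<leftarrow>as. real t + a)"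
  define Y :: "real fps" where "Y = 1 - fps_X"
  let ?s = "length as"
  have P: "fps_of_poly (euler as) = F * Y ^ Suc ?s"
    using Cons.IH by (simp only: F_def Y_def)
  have dY: "fps_deriv (Y ^ Suc ?s) = - of_nat (Suc ?s) * Y ^ ?s"
  proof -
    have "fps_deriv Y = -1"
      by (simp add: Y_def)
    then show ?thesis
      by (simp only: fps_deriv_power' diff_Suc_1) simp
  qed
  have lin: "fps_of_poly [:b, c:] = fps_const b + fps_const c * fps_X" for b c :: real
    by (simp add: fps_of_poly_pCons)
  have quad: "fps_of_poly [:0, 1, -1 :: real:] = fps_X * Y"
    by (simp add: fps_of_poly_pCons Y_def algebra_simps)
  \<comment> \<open>In this form the second summand cancels the term that comes from differentiating
    the power of \<open>Y\<close>.\<close>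
  have aY: "fps_of_poly [:a, real ?s + 1 - a:] = fps_const a * Y + of_nat (Suc ?s) * fps_X"
  proof -
    have eq: "fps_const (real ?s + 1 - a) = of_nat (Suc ?s) - fps_const a"
      unfolding fps_of_nat[symmetric] fps_const_sub by simp
    show ?thesis
      unfolding lin Y_def eq by (simp add: algebra_simps)
  qed
  have "fps_of_poly (euler (a # as)) =
      fps_X * Y * fps_deriv (F * Y ^ Suc ?s) + (fps_const a * Y + of_nat (Suc ?s) * fps_X) * (F * Y ^ Suc ?s)"
    by (simp only: euler.simps euler_step_def fps_of_poly_add fps_of_poly_mult fps_of_poly_pderiv P quad aY)
  also have "\<dots> = (fps_X * fps_deriv F + fps_const a * F) * Y ^ Suc (Suc ?s)"
    unfolding fps_deriv_mult dY by (simp add: algebra_simps)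
  also have "fps_X * fps_deriv F + fps_const a * F = Abs_fps (\<lambda>t. \<Prod>a\<leftarrow>a # as. real t + a)"
    by (rule fps_ext) (simp add: F_def algebra_simps)
  finally show ?case
    by (simp add: Y_def)
qed

text \<open>The recursion depends on the order of the list, but the product in the generating
  function does not.\<close>

lemma euler_mset_cong:
  assumes "mset as = mset bs"
  shows "euler as = euler bs"
proof -
  have "(\<Prod>a\<leftarrow>as. real t + a) = (\<Prod>a\<leftarrow>bs. real t + a)" for t
    using assms by (metis mset_map prod_mset_prod_list)
  moreover have "length as = length bs"
    using assms by (rule mset_eq_length)
  ultimately have "fps_of_poly (euler as) = fps_of_poly (euler bs)"
    by (simp only: flip: fps_euler)
  then show ?thesis
    by (simp only: fps_of_poly_eq_iff)
qed

lemma euler_append_Cons: "euler (xs @ a # ys) = euler_step (length xs + length ys) a (euler (xs @ ys))"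
  using euler_mset_cong[of "xs @ a # ys" "a # xs @ ys"] by simp

lemma coeff_euler_step:
  "coeff (euler_step s a p) i =
     (real i + a) * coeff p i + (if i = 0 then 0 else (real s + 2 - real i - a) * coeff p (i - 1))"
  by (cases i) (auto simp: euler_step_def coeff_pCons coeff_pderiv algebra_simps split: nat.splits)

lemma degree_euler_le: "degree (euler as) \<le> length as"
proof (induction as)
  case (Cons a as)
  show ?case
    by (rule degree_le) (use Cons in \<open>auto simp: coeff_euler_step coeff_eq_0\<close>)
qed simp

text \<open>The two weights \<open>i + a\<close> and \<open>s + 2 - i - a\<close> in
  \<open>coeff_euler_step\<close> are exchanged by replacing \<open>i\<close> with
  \<open>s + 1 - i\<close> and \<open>a\<close> with \<open>1 - a\<close>.\<close>

lemma reciprocal_euler: "reciprocal (length as) (euler as) = euler (map (\<lambda>a. 1 - a) as)"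
proof (induction as)
  case Nil
  show ?case
    by (rule poly_eqI) (simp add: coeff_reciprocal)
next
  case (Cons a as)
  let ?s = "length as"
  have *: "coeff (euler (map (\<lambda>a. 1 - a) as)) i = (if i \<le> ?s then coeff (euler as) (?s - i) else 0)" for i
    by (simp flip: Cons.IH add: coeff_reciprocal)
  show ?case
  proof (rule poly_eqI)
    fix i
    have z: "coeff (euler as) j = 0" if "j > ?s" for j
      using that degree_euler_le[of as] by (intro coeff_eq_0) simp
    \<comment> \<open>At both ends, \<open>0\<close> and \<open>Suc ?s\<close>, only one of the two
      terms of the recursion survives.\<close>
    consider "i = 0" | j where "i = Suc j" "j < ?s" | "i = Suc ?s" | "i > Suc ?s"
      by (cases i) force+
    then show "coeff (reciprocal (length (a # as)) (euler (a # as))) i =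
        coeff (euler (map (\<lambda>a. 1 - a) (a # as))) i"
    proof cases
      case (2 j)
      then have "?s - j - 1 = ?s - Suc j" "?s - j \<noteq> 0" "real (?s - j) = real ?s - real j"
        by auto
      then show ?thesis
        using 2 by (simp add: coeff_reciprocal coeff_euler_step * algebra_simps)
    qed (auto simp: coeff_reciprocal coeff_euler_step * z algebra_simps)
  qed
qed

text \<open>The sequence \<open>t ^ k\<close> is \<open>(t + 1) ^ k\<close> delayed by one place, as
  its first term vanishes for \<open>k > 0\<close>.\<close>

lemma euler_zeros_eq:
  assumes "k > 0"
  shows "euler (replicate k 0) = pCons 0 (euler (replicate k 1))"
proof -
  have *: "Abs_fps (\<lambda>t. real t ^ k) = fps_X * Abs_fps (\<lambda>t. (real t + 1) ^ k)"
    using assms by (intro fps_ext) (auto simp: of_nat_diff)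
  have "fps_of_poly (euler (replicate k 0)) = Abs_fps (\<lambda>t. real t ^ k) * (1 - fps_X) ^ Suc k"
    using fps_euler[of "replicate k 0"] by (simp del: power_Suc)
  moreover have "fps_of_poly (euler (replicate k 1)) = Abs_fps (\<lambda>t. (real t + 1) ^ k) * (1 - fps_X) ^ Suc k"
    using fps_euler[of "replicate k 1"] by (simp del: power_Suc)
  ultimately have "fps_of_poly (euler (replicate k 0)) = fps_of_poly (pCons 0 (euler (replicate k 1)))"
    unfolding fps_of_poly_pCons by (simp add: * mult_ac del: power_Suc)
  then show ?thesis
    by (simp only: fps_of_poly_eq_iff)
qed

lemma poly_euler_step:
  "poly (euler_step s a p) x = x * (1 - x) * poly (pderiv p) x + (a + (real s + 1 - a) * x) * poly p x"
  by (simp add: euler_step_def algebra_simps)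

section \<open>Zeros under a change of the shifts\<close>

text \<open>At a zero \<open>x\<close> of \<open>p\<close> only \<open>x * (1 - x) * p'(x)\<close>
  remains, with sign opposite to \<open>p'(x)\<close> because \<open>x < 0\<close>. So signs
  alternate along \<open>0\<close> and the zeros of \<open>p\<close>, and a further zero lies to the
  left of these if the degree grows.\<close>

lemma neg_zeros_euler_step:
  assumes R: "neg_zeros d p \<rho>" and a: "0 < a" "a + real d \<le> real s + 1"
  obtains \<alpha> where "neg_zeros (if a + real d < real s + 1 then Suc d else d) (euler_step s a p) \<alpha>"
    and "\<And>i. i < d \<Longrightarrow> \<rho> i < \<alpha> i"
    and "\<And>i. Suc i < (if a + real d < real s + 1 then Suc d else d) \<Longrightarrow> \<alpha> (Suc i) < \<rho> i"
proof -
  let ?T = "euler_step s a p"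
  let ?d' = "if a + real d < real s + 1 then Suc d else d"
  have deg: "degree p = d" and lc: "coeff p d > 0"
    using R by (auto simp: neg_zeros_def)
  have root: "poly p (\<rho> i) = 0" "\<rho> i < 0" if "i < d" for i
    using R that by (auto simp: neg_zeros_def)
  have desc: "\<rho> j < \<rho> i" if "i < j" "j < d" for i j
    using R that by (auto simp: neg_zeros_def)
  have top: "coeff ?T (Suc d) = (real s + 1 - real d - a) * coeff p d"
    using deg by (simp add: coeff_euler_step coeff_eq_0 algebra_simps)
  have degT: "degree ?T \<le> ?d'"
  proof (rule degree_le, intro allI impI)
    fix i assume "?d' < i"
    \<comment> \<open>The degree stays at \<open>d\<close> exactly when the factor
      \<open>s + 1 - d - a\<close> of the top coefficient vanishes.\<close>
    then have "i > Suc d \<or> i = Suc d \<and> real s + 1 - real d - a = 0"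
      using a by (auto split: if_splits)
    then show "coeff ?T i = 0"
      using top deg by (auto simp: coeff_euler_step coeff_eq_0)
  qed
  have at0: "0 < poly ?T 0"
    using neg_zeros_pos_at_0[OF R] a by (simp add: poly_euler_step)
  have sign: "(-1) ^ i * poly ?T (\<rho> i) < 0" if "i < d" for i
  proof -
    have "(-1) ^ i * poly ?T (\<rho> i) = \<rho> i * (1 - \<rho> i) * ((-1) ^ i * poly (pderiv p) (\<rho> i))"
      using root[OF that] by (simp add: poly_euler_step)
    also have "\<dots> < 0"
      using neg_zeros_pderiv_sign[OF R that] root[OF that]
      by (intro mult_neg_pos) auto
    finally show ?thesis .
  qed
  \<comment> \<open>The intervals run from \<open>\<rho> i\<close> up to the next larger zero, or up
    to \<open>0\<close> for \<open>i = 0\<close>.\<close>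
  define hi where "hi i = (case i of 0 \<Rightarrow> 0 | Suc j \<Rightarrow> \<rho> j)" for i
  \<comment> \<open>The left end for the extra zero, found near minus infinity; it is arbitrary if
    the degree does not grow.\<close>
  obtain y where y: "a + real d < real s + 1 \<Longrightarrow> y < hi d \<and> (-1) ^ d * poly ?T y < 0"
  proof (cases "a + real d < real s + 1")
    case True
    then have "coeff ?T (Suc d) > 0"
      using top lc by simp
    moreover from this have "degree ?T = Suc d"
      using True degT by (intro antisym le_degree) auto
    ultimately show ?thesis
      using sign_at_minus_infinity[of ?T "hi d"] that by auto
  qed auto
  define lo where "lo i = (if i < d then \<rho> i else y)" for i
  obtain \<alpha> where \<alpha>: "neg_zeros ?d' ?T \<alpha>" "\<And>i. i < ?d' \<Longrightarrow> lo i < \<alpha> i \<and> \<alpha> i < hi i"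
  proof (rule neg_zeros_exist[OF degT at0, of lo hi])
    fix i assume i: "i < ?d'"
    show "lo i < hi i"
    proof (cases "i < d")
      case True
      then show ?thesis
        using root desc by (cases i) (auto simp: lo_def hi_def)
    next
      case False
      then show ?thesis
        using i y by (auto simp: lo_def less_Suc_eq split: if_splits)
    qed
    show "hi i \<le> 0"
      using i root by (cases i) (auto simp: hi_def less_imp_le split: if_splits)
    show "0 < (-1) ^ i * poly ?T (hi i)"
      using i at0 sign by (cases i) (auto simp: hi_def split: if_splits)
    show "(-1) ^ i * poly ?T (lo i) < 0"
      using i sign y by (auto simp: lo_def less_Suc_eq split: if_splits)
  next
    fix i j assume "i < j" "j < ?d'"
    then show "hi j \<le> lo i"
      using desc by (cases j) (auto simp: hi_def lo_def less_Suc_eq intro: less_imp_le split: if_splits)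
  qed blast
  show ?thesis
  proof
    show "neg_zeros ?d' ?T \<alpha>" by fact
    show "\<rho> i < \<alpha> i" if "i < d" for i
      using \<alpha>(2)[of i] that by (auto simp: lo_def split: if_splits)
    show "\<alpha> (Suc i) < \<rho> i" if "Suc i < ?d'" for i
      using \<alpha>(2)[of "Suc i"] that by (auto simp: hi_def)
  qed
qed

text \<open>The two values differ by \<open>(b - a) * (1 - x) * p(x)\<close>, so at a zero of the
  first polynomial the sign of the second is that of \<open>p\<close>.\<close>

lemma neg_zeros_euler_step_less:
  assumes R: "neg_zeros d p \<rho>" and ab: "0 < a" "a < b" "b + real d \<le> real s + 1"
    and A: "neg_zeros k (euler_step s a p) \<alpha>" and B: "neg_zeros l (euler_step s b p) \<beta>"
    and i: "i < l"
  shows "l \<le> k \<and> \<beta> i < \<alpha> i"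
proof -
  let ?l = "if b + real d < real s + 1 then Suc d else d"
  have ad: "a + real d < real s + 1"
    using ab by linarith
  obtain \<alpha>' where \<alpha>': "neg_zeros (Suc d) (euler_step s a p) \<alpha>'"
      "\<And>i. i < d \<Longrightarrow> \<rho> i < \<alpha>' i" "\<And>i. i < d \<Longrightarrow> \<alpha>' (Suc i) < \<rho> i"
    using neg_zeros_euler_step[OF R ab(1) less_imp_le[OF ad]] unfolding if_P[OF ad] Suc_less_eq by blast
  have "0 < b"
    using ab by linarith
  then obtain \<beta>' where \<beta>': "neg_zeros ?l (euler_step s b p) \<beta>'"
      "\<And>i. i < d \<Longrightarrow> \<rho> i < \<beta>' i" "\<And>i. Suc i < ?l \<Longrightarrow> \<beta>' (Suc i) < \<rho> i"
    using neg_zeros_euler_step[OF R _ ab(3)] by blast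
  have k: "k = Suc d" and l: "l = ?l"
    using neg_zerosD(1)[OF A] neg_zerosD(1)[OF \<alpha>'(1)] neg_zerosD(1)[OF B] neg_zerosD(1)[OF \<beta>'(1)]
    by simp_all
  have le: "l \<le> k"
    by (simp add: k l)
  have \<rho>_desc: "\<rho> j' < \<rho> j" if "j < j'" "j' < d" for j j'
    using neg_zerosD(5)[OF R that] .
  have \<beta>_desc: "\<beta>' j' < \<beta>' j" if "j < j'" "j' < ?l" for j j'
    using neg_zerosD(5)[OF \<beta>'(1) that] .
  \<comment> \<open>Exactly \<open>i\<close> zeros of \<open>p\<close> lie above
    \<open>\<alpha>' i\<close>. If \<open>\<beta>' i\<close> were above it too, exactly
    \<open>i + 1\<close> zeros of the second polynomial would be, giving the opposite sign.\<close>
  have "\<beta>' i < \<alpha>' i"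
  proof (rule ccontr)
    assume nless: "\<not> \<beta>' i < \<alpha>' i"
    let ?x = "\<alpha>' i"
    have x: "?x < 0" "poly (euler_step s a p) ?x = 0"
      using neg_zerosD(3,4)[OF \<alpha>'(1), of i] i le k by simp_all
    have up: "?x < \<rho> j" if "j < i" for j
    proof -
      define i' where "i' = i - 1"
      with that have i': "i = Suc i'" "j \<le> i'"
        by simp_all
      then have "\<rho> i' \<le> \<rho> j"
        using \<rho>_desc[of j i'] i le k by (cases "j = i'") auto
      moreover have "?x < \<rho> i'"
        using \<alpha>'(3)[of i'] i' i le k by simp
      ultimately show ?thesis
        by simp
    qed
    have down: "\<rho> j < ?x" if "i \<le> j" "j < d" for j
      using \<alpha>'(2)[of i] that \<rho>_desc[of i j] by (cases "j = i") auto
    have R_sign: "0 < (-1) ^ i * poly p ?x"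
      using i le k by (intro neg_zeros_sign[OF R] up down) simp_all
    have "poly (euler_step s b p) ?x = (b - a) * (1 - ?x) * poly p ?x"
      using x(2) by (simp add: poly_euler_step algebra_simps)
    then have "(-1) ^ i * poly (euler_step s b p) ?x = (b - a) * (1 - ?x) * ((-1) ^ i * poly p ?x)"
      by simp
    also have "\<dots> > 0"
      using ab x(1) by (intro mult_pos_pos[OF _ R_sign] mult_pos_pos) auto
    finally have pos: "0 < (-1) ^ i * poly (euler_step s b p) ?x" .
    show False
    proof (cases "\<beta>' i = ?x")
      case True
      then show False
        using pos neg_zerosD(3)[OF \<beta>'(1), of i] i l by simp
    next
      case False
      then have less: "?x < \<beta>' i"
        using nless by simp
      have "0 < (-1) ^ Suc i * poly (euler_step s b p) ?x"
      proof (rule neg_zeros_sign[OF \<beta>'(1)])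
        show "Suc i \<le> ?l" using i l by simp
        show "?x < \<beta>' j" if "j < Suc i" for j
          using less that \<beta>_desc[of j i] i l by (cases "j = i") auto
        show "\<beta>' j < ?x" if "Suc i \<le> j" "j < ?l" for j
        proof -
          define j' where "j' = j - 1"
          with \<open>Suc i \<le> j\<close> have j': "j = Suc j'" "i \<le> j'"
            by simp_all
          then have "\<beta>' j < \<rho> j'" "\<rho> j' < ?x"
            using \<beta>'(3)[of j'] down[of j'] that by (simp_all split: if_splits)
          then show ?thesis by simp
        qed
      qed
      then show False
        using pos by simp
    qed
  qed
  then show ?thesis
    using neg_zeros_unique[OF A \<alpha>'(1)[folded k]] neg_zeros_unique[OF B \<beta>'(1)[folded l]] i le by simp
qed

text \<open>
  The shift \<open>1\<close> stands for a factor \<open>t + 1\<close>; this vanishes at \<open>t = -1\<close>, so the degree drops by one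
  (only once, because \<open>t = -2\<close> is not a zero).
\<close>

definition euler_degree :: "real list \<Rightarrow> nat" where
  "euler_degree as = (if 1 \<in> set as then length as - 1 else length as)"

lemma neg_zeros_euler:
  assumes "set as \<subseteq> {0<..1}"
  shows "\<exists>\<alpha>. neg_zeros (euler_degree as) (euler as) \<alpha>"
  using assms
proof (induction as)
  case Nil
  show ?case
    by (simp add: neg_zeros_def euler_degree_def)
next
  case (Cons a as)
  then obtain \<rho> where \<rho>: "neg_zeros (euler_degree as) (euler as) \<rho>"
    by auto
  have le: "euler_degree as \<le> length as"
    by (simp add: euler_degree_def)
  \<comment> \<open>A shift \<open>1\<close> in \<open>as\<close> has already lowered the degree, so
    any further shift raises it; without one, the degree stalls exactly for
    \<open>a = 1\<close>.\<close>
  have "(if a + real (euler_degree as) < real (length as) + 1 then Suc (euler_degree as) else euler_degree as) =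
      euler_degree (a # as)"
  proof (cases "1 \<in> set as")
    case True
    then have "length as \<ge> 1"
      by (cases as) auto
    then show ?thesis
      using True Cons.prems by (auto simp: euler_degree_def of_nat_diff)
  qed (use Cons.prems in \<open>auto simp: euler_degree_def\<close>)
  moreover have "0 < a" "a + real (euler_degree as) \<le> real (length as) + 1"
    using Cons.prems le by auto
  from neg_zeros_euler_step[OF \<rho> this] obtain \<alpha> where
    "neg_zeros (if a + real (euler_degree as) < real (length as) + 1 then Suc (euler_degree as)
       else euler_degree as) (euler (a # as)) \<alpha>"
    unfolding euler.simps by blast
  ultimately show ?case
    by auto
qed

text \<open>By symmetry the altered shift can be applied last, to the common polynomial of all other
  shifts.\<close>

lemma neg_zeros_euler_mono_1:
  assumes "set (xs @ a # ys) \<subseteq> {0<..1}" and "0 < a" "a < b" "b \<le> 1"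
    and "neg_zeros k (euler (xs @ a # ys)) \<alpha>" and "neg_zeros l (euler (xs @ b # ys)) \<beta>"
    and "i < l"
  shows "l \<le> k \<and> \<beta> i < \<alpha> i"
proof -
  obtain \<rho> where \<rho>: "neg_zeros (euler_degree (xs @ ys)) (euler (xs @ ys)) \<rho>"
    using neg_zeros_euler[of "xs @ ys"] assms(1) by auto
  have "euler_degree (xs @ ys) \<le> length xs + length ys"
    by (auto simp: euler_degree_def)
  then have "b + real (euler_degree (xs @ ys)) \<le> real (length xs + length ys) + 1"
    using assms(4) by linarith
  from neg_zeros_euler_step_less[OF \<rho> assms(2,3) this] show ?thesis
    using assms(5-7) unfolding euler_append_Cons by blast
qed

text \<open>The shifts are raised one at a time from left to right; each genuine change moves the
  zeros strictly.\<close>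

lemma neg_zeros_euler_mono:
  assumes "list_all2 (\<le>) as bs" and "set as \<subseteq> {0<..1}" and "set bs \<subseteq> {0<..1}" and "as \<noteq> bs"
    and "neg_zeros k (euler as) \<alpha>" and "neg_zeros l (euler bs) \<beta>"
    and "i < l"
  shows "l \<le> k \<and> \<beta> i < \<alpha> i"
proof -
  \<comment> \<open>The prefix \<open>xs\<close> holds the entries already raised. The left
    polynomial changes along the way, so \<open>k\<close> and \<open>\<alpha>\<close> vary, while
    \<open>l\<close> and \<open>\<beta>\<close> stay fixed.\<close>
  have "l \<le> k \<and> \<beta> i < \<alpha> i"
    if "set xs \<subseteq> {0<..1}" "neg_zeros k (euler (xs @ as)) \<alpha>" "neg_zeros l (euler (xs @ bs)) \<beta>" for xs k \<alpha>
    using assms(1-4) that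
  proof (induction arbitrary: xs k \<alpha> rule: list_all2_induct)
    case (Cons a as b bs)
    show ?case
    proof (cases "a = b")
      case True
      then show ?thesis
        using Cons.IH[of "xs @ [a]" k \<alpha>] Cons.prems by auto
    next
      case False
      then have "a < b"
        using Cons.hyps by simp
      \<comment> \<open>The zeros at the intermediate list, where only \<open>a\<close> has been
        raised to \<open>b\<close>.\<close>
      obtain \<gamma> where \<gamma>: "neg_zeros (euler_degree (xs @ b # as)) (euler (xs @ b # as)) \<gamma>"
        using neg_zeros_euler[of "xs @ b # as"] Cons.prems by auto
      let ?g = "euler_degree (xs @ b # as)"
      have step: "?g \<le> k \<and> \<gamma> i < \<alpha> i" if "i < ?g"
        using neg_zeros_euler_mono_1[of xs a as b k \<alpha> ?g \<gamma> i] \<gamma> \<open>a < b\<close> Cons.prems that by auto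
      show ?thesis
      proof (cases "as = bs")
        case True
        then have \<beta>: "neg_zeros l (euler (xs @ b # as)) \<beta>"
          using Cons.prems(6) by simp
        have "?g = l"
          using neg_zerosD(1)[OF \<gamma>] neg_zerosD(1)[OF \<beta>] by simp
        moreover from this have "\<gamma> i = \<beta> i"
          using neg_zeros_unique[OF _ \<beta> assms(7)] \<gamma> by simp
        ultimately have "?g = l" "\<gamma> i = \<beta> i"
          by simp_all
        then show ?thesis
          using step assms(7) by simp
      next
        case False
        then have "l \<le> ?g \<and> \<beta> i < \<gamma> i"
          using Cons.IH[of "xs @ [b]" ?g \<gamma>] Cons.prems \<gamma> by auto
        then show ?thesis
          using step assms(7) by auto
      qed
    qed
  qed simp
  from this[of "[]"] assms show ?thesis
    by simp
qed

text \<open>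
  The zeros \<open>e\<^sub>i\<close> for the shifts \<open>1, \<dots>, 1\<close> separate: \<open>e\<^sub>i < \<beta>\<^sub>i\<close> by monotonicity, and \<open>\<alpha>\<^sub>i\<^sub>+\<^sub>1 < e\<^sub>i\<close> is the
  reciprocal of the same inequality, as both families of zeros are exchanged by \<open>x \<mapsto> 1 / x\<close>.
\<close>

lemma neg_zeros_euler_interlace:
  assumes as: "set as \<subseteq> {0<..<1}" and bs: "mset bs = mset (map (\<lambda>a. 1 - a) as)"
    and \<alpha>: "neg_zeros (length as) (euler as) \<alpha>" and \<beta>: "neg_zeros (length as) (euler bs) \<beta>"
    and i: "Suc i < length as"
  shows "\<alpha> (Suc i) < \<beta> i"
proof -
  let ?m = "length as"
  let ?ones = "replicate ?m (1 :: real)"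
  have "euler_degree ?ones = ?m - 1"
    using i by (auto simp: euler_degree_def)
  moreover have ones: "set ?ones \<subseteq> {0<..1}"
    by (auto simp: in_set_replicate)
  ultimately obtain e where e: "neg_zeros (?m - 1) (euler ?ones) e"
    using neg_zeros_euler[of ?ones] by metis
  have below: "e j < \<gamma> j" if "set cs \<subseteq> {0<..<1}" "length cs = ?m" "neg_zeros ?m (euler cs) \<gamma>" "j < ?m - 1" for cs \<gamma> j
  proof -
    have "cs \<noteq> ?ones"
    proof
      assume "cs = ?ones"
      then have "1 \<in> set cs"
        using i by auto
      then show False
        using that(1) by auto
    qed
    moreover have "list_all2 (\<le>) cs ?ones"
    proof (rule list_all2_all_nthI)
      fix j assume j: "j < length cs"
      then have "cs ! j \<in> {0<..<1}"
        using that(1) nth_mem by blast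
      then show "cs ! j \<le> ?ones ! j"
        using j that(2) by simp
    qed (use that(2) in simp)
    ultimately show ?thesis
      using neg_zeros_euler_mono[OF _ _ ones _ that(3) e that(4), THEN conjunct2] that(1) by force
  qed
  have pos: "0 < ?m"
    using i by linarith
  \<comment> \<open>The reciprocal turns the shifts \<open>1\<close> into \<open>0\<close>, which
    only adds a factor \<open>x\<close>; removing it lowers the reference degree to
    \<open>?m - 1\<close>.\<close>
  have palin: "reciprocal (?m - 1) (euler ?ones) = euler ?ones"
  proof (rule poly_eqI)
    fix j
    have "reciprocal ?m (euler ?ones) = pCons 0 (euler ?ones)"
      using reciprocal_euler[of ?ones] euler_zeros_eq[OF pos] by simp
    then have "coeff (reciprocal ?m (euler ?ones)) (Suc j) = coeff (euler ?ones) j"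
      by simp
    then show "coeff (reciprocal (?m - 1) (euler ?ones)) j = coeff (euler ?ones) j"
      using i by (auto simp: coeff_reciprocal split: if_splits)
  qed
  \<comment> \<open>There are only \<open>?m - 1\<close> zeros \<open>e\<close>, so inversion sends
    index \<open>i\<close> to \<open>?m - 2 - i\<close>.\<close>
  have e_inv: "e i = 1 / e (?m - 2 - i)"
    using neg_zeros_unique[OF e neg_zeros_reciprocal[OF e, unfolded palin], of i] i by (simp add: numeral_2_eq_2)
  have len: "length bs = ?m"
    using bs by (metis mset_eq_length length_map)
  have "set bs \<subseteq> {0<..<1}"
  proof -
    have "set bs = set (map (\<lambda>a. 1 - a) as)"
      using bs by (metis set_mset_mset)
    then show ?thesis
      using as by auto
  qed
  then have lower: "e i < \<beta> i"
    using below[of bs \<beta> i] len \<beta> i by simp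
  have "reciprocal ?m (euler as) = euler bs"
    using reciprocal_euler euler_mset_cong[OF bs] by simp
  then have "neg_zeros ?m (euler bs) (\<lambda>i. 1 / \<alpha> (?m - 1 - i))"
    using neg_zeros_reciprocal[OF \<alpha>] by simp
  moreover have "?m - 2 - i < ?m - 1"
    using i by linarith
  ultimately have "e (?m - 2 - i) < 1 / \<alpha> (?m - 1 - (?m - 2 - i))"
    by (rule below[OF \<open>set bs \<subseteq> {0<..<1}\<close> len])
  moreover have "?m - 1 - (?m - 2 - i) = Suc i"
    using i by simp
  ultimately have less: "e (?m - 2 - i) < 1 / \<alpha> (Suc i)"
    by simp
  have neg: "\<alpha> (Suc i) < 0" "e (?m - 2 - i) < 0"
    using \<alpha> e i by (auto simp: neg_zeros_def)
  have "\<alpha> (Suc i) < 1 / e (?m - 2 - i)"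
    using less neg by (simp add: divide_simps mult.commute split: if_splits)
  then show ?thesis
    using lower e_inv by simp
qed

section \<open>Counting words with bars\<close>

text \<open>Bars come first, then color before letter, so that the lexicographic order extends the
  order of colored letters.\<close>

definition key :: "nat \<Rightarrow> letter \<Rightarrow> nat \<times> nat \<times> nat" where
  "key s x = (s, snd x, fst x)"

definition letter_of :: "nat \<times> nat \<times> nat \<Rightarrow> letter" where
  "letter_of z = (snd (snd z), fst (snd z))"

text \<open>
  A triple \<open>(s, c, k)\<close> is the letter \<open>k\<close> of color \<open>c\<close> with \<open>s\<close> bars to its left, so that sorting means: weakly
  increasing letters between two consecutive bars. The letter \<open>y\<close> is the one that follows the word.
\<close>

definition barred :: "letter list \<Rightarrow> letter \<Rightarrow> nat \<Rightarrow> (nat \<times> nat \<times> nat) list set" where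
  "barred w y t = {L. sorted (L @ [key t y]) \<and> map letter_of L = w}"

text \<open>The appended letter is a parameter because induction from the right replaces it by the
  last letter of the word.\<close>

definition descents :: "letter list \<Rightarrow> letter \<Rightarrow> nat" where
  "descents w y = card {j. j < length w \<and> letter_less ((w @ [y]) ! Suc j) ((w @ [y]) ! j)}"

lemma des_eq_descents: "des n w = descents w (n + 1, 1)"
  by (simp add: des_def descents_def Let_def)

lemma letter_of_key [simp]: "letter_of (key s x) = x"
  by (simp add: letter_of_def key_def)

lemma key_letter_of [simp]: "key (fst z) (letter_of z) = z"
  by (simp add: letter_of_def key_def)

text \<open>A descent from \<open>x\<close> to \<open>y\<close> forces a bar between them; elsewhere
  bars are optional.\<close>

lemma key_le_iff: "key s x \<le> key t y \<longleftrightarrow> s < t \<or> s = t \<and> \<not> letter_less y x"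
  by (cases x; cases y) (auto simp: key_def letter_less_def less_eq_prod_def)

lemma descents_Nil [simp]: "descents [] y = 0"
  by (simp add: descents_def)

lemma descents_snoc:
  "descents (w @ [x]) y = descents w x + (if letter_less y x then 1 else 0)"
proof -
  let ?D = "{j. j < length w \<and> letter_less ((w @ [x]) ! Suc j) ((w @ [x]) ! j)}"
  have "{j. j < length (w @ [x]) \<and> letter_less (((w @ [x]) @ [y]) ! Suc j) (((w @ [x]) @ [y]) ! j)} =
      ?D \<union> (if letter_less y x then {length w} else {})"
    by (auto simp: nth_append less_Suc_eq split: if_splits)
  moreover have "finite ?D" "length w \<notin> ?D"
    by auto
  ultimately show ?thesis
    by (simp add: descents_def)
qed

lemma barred_snoc:
  "barred (w @ [x]) y t = (\<Union>s\<in>{s. key s x \<le> key t y}. (\<lambda>L. L @ [key s x]) ` barred w x s)"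
proof (intro set_eqI iffI)
  fix L
  assume "L \<in> barred (w @ [x]) y t"
  then have L: "sorted (L @ [key t y])" "map letter_of L = w @ [x]"
    by (auto simp: barred_def)
  then obtain L' z where z: "L = L' @ [z]" "map letter_of L' = w" "letter_of z = x"
    by (auto simp: map_eq_append_conv)
  then have "z = key (fst z) x"
    by (metis key_letter_of)
  then show "L \<in> (\<Union>s\<in>{s. key s x \<le> key t y}. (\<lambda>L. L @ [key s x]) ` barred w x s)"
    using L z by (auto simp: barred_def sorted_append intro!: exI[of _ "fst z"] image_eqI[of _ _ L'])
next
  fix L
  assume "L \<in> (\<Union>s\<in>{s. key s x \<le> key t y}. (\<lambda>L. L @ [key s x]) ` barred w x s)"
  then show "L \<in> barred (w @ [x]) y t"
    by (auto simp: barred_def sorted_append intro: order_trans)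
qed

lemma finite_key_le: "finite {s. key s x \<le> key t y}"
  by (rule finite_subset[of _ "{..t}"]) (auto simp: key_le_iff)

lemma finite_barred: "finite (barred w y t)"
proof (induction w arbitrary: y t rule: rev_induct)
  case Nil
  have "barred [] y t \<subseteq> {[]}"
    by (auto simp: barred_def)
  then show ?case
    by (rule finite_subset) simp
next
  case (snoc x w)
  then show ?case
    unfolding barred_snoc using finite_key_le by blast
qed

lemma card_barred_snoc:
  "card (barred (w @ [x]) y t) = (\<Sum>s\<in>{s. key s x \<le> key t y}. card (barred w x s))"
proof -
  have "card (barred (w @ [x]) y t) =
      (\<Sum>s\<in>{s. key s x \<le> key t y}. card ((\<lambda>L. L @ [key s x]) ` barred w x s))"
    unfolding barred_snoc using finite_key_le finite_barred
    by (intro card_UN_disjoint) (auto simp: key_def)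
  also have "\<dots> = (\<Sum>s\<in>{s. key s x \<le> key t y}. card (barred w x s))"
    by (intro sum.cong card_image refl) (auto simp: inj_on_def)
  finally show ?thesis .
qed

text \<open>Appending \<open>x\<close> sums over the bars \<open>s\<close> to its left, with
  \<open>s \<le> t\<close>, or \<open>s < t\<close> at a descent. Partial summation divides by
  \<open>1 - fps_X\<close>, and strictness costs a factor \<open>fps_X\<close>.\<close>

lemma fps_barred:
  "Abs_fps (\<lambda>t. real (card (barred w y t))) * (1 - fps_X) ^ Suc (length w) = fps_X ^ descents w y"
proof (induction w arbitrary: y rule: rev_induct)
  case Nil
  have "barred [] y t = {[]}" for t
    by (auto simp: barred_def)
  moreover have "Abs_fps (\<lambda>t. 1) * (1 - fps_X) = (1 :: real fps)"
    by (rule fps_ext) (simp add: algebra_simps)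
  ultimately show ?case
    by simp
next
  case (snoc x w)
  let ?F = "Abs_fps (\<lambda>t. real (card (barred (w @ [x]) y t)))"
  let ?G = "Abs_fps (\<lambda>t. real (card (barred w x t)))"
  have F: "?F $ t = (\<Sum>s\<in>{s. key s x \<le> key t y}. ?G $ s)" for t
    by (simp add: card_barred_snoc)
  have "?F * (1 - fps_X) = fps_X ^ (if letter_less y x then 1 else 0) * ?G"
  proof (rule fps_ext)
    fix t
    have "(?F * (1 - fps_X)) $ t = ?F $ t - (if t = 0 then 0 else ?F $ (t - 1))"
      by (simp add: algebra_simps)
    also have "\<dots> = (fps_X ^ (if letter_less y x then 1 else 0) * ?G) $ t"
    proof (cases "letter_less y x")
      case True
      then have "{s. key s x \<le> key u y} = {..<u}" for u
        by (auto simp: key_le_iff)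
      with True show ?thesis
        unfolding F by (cases t) auto
    next
      case False
      then have "{s. key s x \<le> key u y} = {..u}" for u
        by (auto simp: key_le_iff)
      with False show ?thesis
        unfolding F by (cases t) auto
    qed
    finally show "(?F * (1 - fps_X)) $ t = (fps_X ^ (if letter_less y x then 1 else 0) * ?G) $ t" .
  qed
  then have "?F * (1 - fps_X) * (1 - fps_X) ^ Suc (length w) =
      fps_X ^ (if letter_less y x then 1 else 0) * (?G * (1 - fps_X) ^ Suc (length w))"
    by (simp only: mult.assoc)
  also have "\<dots> = fps_X ^ descents (w @ [x]) y"
    unfolding snoc.IH descents_snoc by (simp add: power_add)
  finally show ?case
    by (simp add: mult_ac)
qed

section \<open>Multisets with prescribed numbers from disjoint blocks\<close>

definition multisets_over :: "'i set \<Rightarrow> ('i \<Rightarrow> 'a set) \<Rightarrow> ('i \<Rightarrow> nat) \<Rightarrow> 'a multiset set" where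
  "multisets_over K X m = {M. set_mset M \<subseteq> (\<Union>k\<in>K. X k) \<and> (\<forall>k\<in>K. size {#x \<in># M. x \<in> X k#} = m k)}"

text \<open>A multiset over disjoint blocks is the sum of its parts in the blocks; the induction
  splits off one block.\<close>

lemma card_multisets_over:
  fixes X :: "'i \<Rightarrow> 'a set"
  assumes "finite K" and "disjoint_family_on X K"
  shows "card (multisets_over K X m) = (\<Prod>k\<in>K. card (multisets_of_size (X k) (m k)))"
  using assms
proof (induction K rule: finite_induct)
  case empty
  have "multisets_over {} X m = {{#}}"
    by (auto simp: multisets_over_def)
  then show ?case
    by simp
next
  case (insert a K)
  have disj: "x \<notin> X k" if "x \<in> X a" "k \<in> K" for x k
    using insert.prems insert.hyps(2) that by (force simp: disjoint_family_on_def)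
  have filter_id: "{#x \<in># M. P x#} = M" if "\<And>x. x \<in># M \<Longrightarrow> P x" for P and M :: "'a multiset"
    using that by (induction M) auto
  have filter_empty: "{#x \<in># M. P x#} = {#}" if "\<And>x. x \<in># M \<Longrightarrow> \<not> P x" for P and M :: "'a multiset"
    using that by (induction M) auto
  let ?f = "\<lambda>(A, B). A + B"
  let ?g = "\<lambda>M. ({#x \<in># M. x \<in> X a#}, {#x \<in># M. x \<notin> X a#})"
  let ?S = "multisets_of_size (X a) (m a) \<times> multisets_over K X m"
  let ?T = "multisets_over (insert a K) X m"
  have split: "{#x \<in># A. x \<in> X a#} = A" "{#x \<in># B. x \<in> X a#} = {#}"
      "{#x \<in># A. x \<notin> X a#} = {#}" "{#x \<in># B. x \<notin> X a#} = B"
    if "A \<in> multisets_of_size (X a) (m a)" and "B \<in> multisets_over K X m" for A B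
  proof -
    have A: "set_mset A \<subseteq> X a" and B: "set_mset B \<subseteq> (\<Union>k\<in>K. X k)"
      using that by (auto simp: multisets_of_size_def multisets_over_def)
    show "{#x \<in># A. x \<in> X a#} = A"
      using A by (intro filter_id) blast
    show "{#x \<in># B. x \<in> X a#} = {#}"
      using B disj by (intro filter_empty) blast
    show "{#x \<in># A. x \<notin> X a#} = {#}"
      using A by (intro filter_empty) blast
    show "{#x \<in># B. x \<notin> X a#} = B"
      using B disj by (intro filter_id) blast
  qed
  have "bij_betw ?f ?S ?T"
  proof (rule bij_betw_byWitness[where f' = ?g])
    show "\<forall>z\<in>?S. ?g (?f z) = z"
      by (auto simp: split)
    show "\<forall>M\<in>?T. ?f (?g M) = M"
      by (auto simp flip: multiset_partition)
    show "?f ` ?S \<subseteq> ?T"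
    proof clarify
      fix A B
      assume A: "A \<in> multisets_of_size (X a) (m a)" and B: "B \<in> multisets_over K X m"
      have "{#x \<in># A. x \<in> X k#} = {#}" if "k \<in> K" for k
        using A that disj by (auto simp: multisets_of_size_def intro!: filter_empty)
      then show "A + B \<in> ?T"
        using A B split[OF A B] by (auto simp: multisets_of_size_def multisets_over_def)
    qed
    show "?g ` ?T \<subseteq> ?S"
    proof clarify
      fix M
      assume M: "M \<in> ?T"
      have "{#x \<in># {#x \<in># M. x \<notin> X a#}. x \<in> X k#} = {#x \<in># M. x \<in> X k#}" if "k \<in> K" for k
        unfolding filter_filter_mset using disj that by (intro filter_mset_cong) auto
      then show "{#x \<in># M. x \<in> X a#} \<in> multisets_of_size (X a) (m a) \<and>
          {#x \<in># M. x \<notin> X a#} \<in> multisets_over K X m"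
        using M by (auto simp: multisets_of_size_def multisets_over_def)
    qed
  qed
  then have "card ?T = card ?S"
    by (simp add: bij_betw_same_card)
  also have "\<dots> = card (multisets_of_size (X a) (m a)) * card (multisets_over K X m)"
    by (rule card_cartesian_product)
  also have "card (multisets_over K X m) = (\<Prod>k\<in>K. card (multisets_of_size (X k) (m k)))"
    using insert by (auto simp: disjoint_family_on_def)
  finally show ?case
    using insert.hyps by simp
qed

text \<open>The places for a letter \<open>k\<close> among \<open>t\<close> bars: every color before
  the last bar, but after it only color \<open>1\<close>, since the word must end below
  \<open>(n + 1, 1)\<close>.\<close>

definition keys :: "(nat \<Rightarrow> nat) \<Rightarrow> nat \<Rightarrow> nat \<Rightarrow> (nat \<times> nat \<times> nat) set" where
  "keys r t k = (\<lambda>(s, c). (s, c, k)) ` ({..<t} \<times> {1..r k} \<union> {(t, 1)})"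

lemma mem_keys:
  "(s, c, k') \<in> keys r t k \<longleftrightarrow> k' = k \<and> (s < t \<and> 1 \<le> c \<and> c \<le> r k \<or> s = t \<and> c = 1)"
  by (auto simp: keys_def image_iff)

lemma card_keys: "card (keys r t k) = r k * t + 1"
proof -
  have "card (keys r t k) = card ({..<t} \<times> {1..r k} \<union> {(t, 1)})"
    unfolding keys_def by (intro card_image) (auto simp: inj_on_def)
  also have "\<dots> = r k * t + 1"
    by (subst card_Un_disjoint) (auto simp: card_cartesian_product)
  finally show ?thesis .
qed

lemma mem_keys_iff:
  assumes "1 \<le> r k" and "k \<le> n"
  shows "(s, c, k) \<in> keys r t k \<longleftrightarrow> (s, c, k) \<le> key t (n + 1, 1) \<and> 1 \<le> c \<and> c \<le> r k"
  using assms by (auto simp: mem_keys key_def less_eq_prod_def)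

text \<open>A barred word determines its word, and being sorted it is determined by its multiset of
  triples. So one chooses, for each \<open>k\<close>, a multiset of size \<open>m k\<close> from
  \<open>r k * t + 1\<close> triples.\<close>

lemma sum_card_barred:
  assumes "\<forall>k\<in>{1..n}. 1 \<le> r k"
  shows "(\<Sum>w\<in>colored_multiset_perms n m r. card (barred w (n + 1, 1) t)) =
    (\<Prod>k=1..n. (r k * t + m k) choose m k)"
proof -
  let ?y = "(n + 1, 1)"
  let ?U = "\<Union>w\<in>colored_multiset_perms n m r. barred w ?y t"
  have "(\<Sum>w\<in>colored_multiset_perms n m r. card (barred w ?y t)) = card ?U"
    using finite_colored_multiset_perms finite_barred
    by (intro card_UN_disjoint[symmetric]) (auto simp: barred_def)
  also have "\<dots> = card (multisets_over {1..n} (keys r t) m)"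
  proof (rule bij_betw_same_card, rule bij_betw_byWitness[where f = mset and f' = sorted_list_of_multiset])
    let ?M = "multisets_over {1..n} (keys r t) m"
    have U_iff: "L \<in> ?U \<longleftrightarrow> sorted L \<and> mset L \<in> ?M" for L
    proof -
      \<comment> \<open>The bound by the appended letter and the admissibility of letters and colors
        together describe the blocks \<open>keys r t k\<close>.\<close>
      have mem: "(\<forall>z\<in>set L. z \<le> key t ?y) \<and>
            (\<forall>z\<in>set L. case letter_of z of (k, c) \<Rightarrow> k \<in> {1..n} \<and> 1 \<le> c \<and> c \<le> r k) \<longleftrightarrow>
          set L \<subseteq> (\<Union>k\<in>{1..n}. keys r t k)"
      proof -
        have "z \<le> key t ?y \<and> (case letter_of z of (k, c) \<Rightarrow> k \<in> {1..n} \<and> 1 \<le> c \<and> c \<le> r k) \<longleftrightarrow>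
            z \<in> (\<Union>k\<in>{1..n}. keys r t k)" for z
        proof -
          obtain s c k where z: "z = (s, c, k)"
            by (cases z)
          have "z \<in> (\<Union>k\<in>{1..n}. keys r t k) \<longleftrightarrow> k \<in> {1..n} \<and> z \<in> keys r t k"
            by (auto simp: z mem_keys)
          then show ?thesis
            using mem_keys_iff[of r k n s c t] assms by (auto simp: z letter_of_def)
        qed
        then show ?thesis
          unfolding ball_conj_distrib[symmetric] by (simp only: subset_iff Ball_def)
      qed
      have key_of: "z \<in> keys r t k \<longleftrightarrow> fst (letter_of z) = k" if "z \<in> (\<Union>k\<in>{1..n}. keys r t k)" for z k
        using that by (cases z) (auto simp: mem_keys letter_of_def)
      have count: "count_list (map fst (map letter_of L)) k = size {#z \<in># mset L. z \<in> keys r t k#}"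
        if "set L \<subseteq> (\<Union>k\<in>{1..n}. keys r t k)" for k
        using that by (induction L) (simp_all add: key_of)
      have len: "length L = (\<Sum>k=1..n. count_list (map fst (map letter_of L)) k)"
        if "set L \<subseteq> (\<Union>k\<in>{1..n}. keys r t k)"
      proof -
        have "set (map fst (map letter_of L)) \<subseteq> {1..n}"
          using that by (auto simp: letter_of_def mem_keys)
        from sum_count_set[OF this] show ?thesis
          by simp
      qed
      have "L \<in> ?U \<longleftrightarrow> sorted L \<and> (\<forall>z\<in>set L. z \<le> key t ?y) \<and> map letter_of L \<in> colored_multiset_perms n m r"
        by (auto simp: barred_def sorted_append)
      also have "\<dots> \<longleftrightarrow> sorted L \<and> set L \<subseteq> (\<Union>k\<in>{1..n}. keys r t k) \<and> length L = (\<Sum>k=1..n. m k) \<and>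
          (\<forall>k\<in>{1..n}. count_list (map fst (map letter_of L)) k = m k)"
        unfolding colored_multiset_perms_def mem_Collect_eq mem[symmetric] set_map ball_simps length_map
        by (simp only: conj_ac)
      also have "\<dots> \<longleftrightarrow> sorted L \<and> mset L \<in> ?M"
        unfolding multisets_over_def mem_Collect_eq set_mset_mset using count len by auto
      finally show ?thesis .
    qed
    show "\<forall>L\<in>?U. sorted_list_of_multiset (mset L) = L"
    proof
      fix L assume "L \<in> ?U"
      then show "sorted_list_of_multiset (mset L) = L"
        using U_iff sorted_sort_id by (metis sorted_list_of_multiset_mset)
    qed
    show "\<forall>M\<in>?M. mset (sorted_list_of_multiset M) = M"
      by simp
    show "mset ` ?U \<subseteq> ?M"
      using U_iff by blast
    show "sorted_list_of_multiset ` ?M \<subseteq> ?U"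
    proof clarify
      fix M assume "M \<in> ?M"
      then show "sorted_list_of_multiset M \<in> ?U"
        unfolding U_iff by simp
    qed
  qed
  also have "\<dots> = (\<Prod>k=1..n. card (multisets_of_size (keys r t k) (m k)))"
    by (rule card_multisets_over) (auto simp: disjoint_family_on_def mem_keys)
  also have "\<dots> = (\<Prod>k=1..n. (r k * t + m k) choose m k)"
    by (intro prod.cong refl, subst card_multisets_of_size) (auto simp: card_keys, simp add: keys_def)
  finally show ?thesis .
qed

text \<open>All words have the same length, so \<open>fps_barred\<close> can be summed with one
  common power of \<open>1 - fps_X\<close>.\<close>

lemma fps_eulerian_poly:
  assumes "\<forall>k\<in>{1..n}. 1 \<le> r k"
  shows "fps_of_poly (eulerian_poly n m r) =
    Abs_fps (\<lambda>t. \<Prod>k=1..n. real ((r k * t + m k) choose m k)) * (1 - fps_X) ^ Suc (\<Sum>k=1..n. m k)"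
proof -
  let ?W = "colored_multiset_perms n m r"
  let ?F = "\<lambda>w. Abs_fps (\<lambda>t. real (card (barred w (n + 1, 1) t)))"
  have "fps_of_poly (eulerian_poly n m r) = (\<Sum>w\<in>?W. fps_X ^ des n w)"
    by (simp add: eulerian_poly_def fps_of_poly_sum fps_of_poly_monom')
  also have "\<dots> = (\<Sum>w\<in>?W. ?F w * (1 - fps_X) ^ Suc (\<Sum>k=1..n. m k))"
  proof (rule sum.cong)
    fix w assume "w \<in> ?W"
    then have "length w = (\<Sum>k=1..n. m k)"
      by (simp add: colored_multiset_perms_def)
    then show "fps_X ^ des n w = ?F w * (1 - fps_X) ^ Suc (\<Sum>k=1..n. m k)"
      using fps_barred[of w "(n + 1, 1)"] by (simp only: des_eq_descents)
  qed simp
  also have "\<dots> = (\<Sum>w\<in>?W. ?F w) * (1 - fps_X) ^ Suc (\<Sum>k=1..n. m k)"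
    by (simp only: sum_distrib_right)
  also have "(\<Sum>w\<in>?W. ?F w) = Abs_fps (\<lambda>t. \<Prod>k=1..n. real ((r k * t + m k) choose m k))"
  proof (rule fps_ext)
    fix t
    have "(\<Sum>w\<in>?W. ?F w) $ t = real (\<Sum>w\<in>?W. card (barred w (n + 1, 1) t))"
      by (simp add: fps_sum_nth)
    then show "(\<Sum>w\<in>?W. ?F w) $ t = Abs_fps (\<lambda>t. \<Prod>k=1..n. real ((r k * t + m k) choose m k)) $ t"
      by (simp only: sum_card_barred[OF assms] of_nat_prod fps_nth_Abs_fps)
  qed
  finally show ?thesis .
qed

section \<open>Interlacing with the reciprocal\<close>

text \<open>These are the negated zeros, in \<open>t\<close>, of the binomial coefficients
  \<open>(r k * t + m k) choose m k\<close>.\<close>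

definition shifts :: "nat \<Rightarrow> (nat \<Rightarrow> nat) \<Rightarrow> (nat \<Rightarrow> nat) \<Rightarrow> real list" where
  "shifts n m r = concat (map (\<lambda>k. map (\<lambda>i. real (Suc i) / real (r k)) [0..<m k]) [1..<Suc n])"

text \<open>The numbers \<open>1 - a\<close>, ordered so that they dominate the shifts \<open>a\<close> entry by entry.\<close>

definition dual_shifts :: "nat \<Rightarrow> (nat \<Rightarrow> nat) \<Rightarrow> (nat \<Rightarrow> nat) \<Rightarrow> real list" where
  "dual_shifts n m r =
     concat (map (\<lambda>k. map (\<lambda>i. 1 - real (m k - i) / real (r k)) [0..<m k]) [1..<Suc n])"

lemma length_shifts: "length (shifts n m r) = (\<Sum>k=1..n. m k)"
proof -
  have "length (shifts n m r) = sum_list (map m [1..<Suc n])"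
    by (simp add: shifts_def length_concat comp_def del: upt_Suc)
  also have "\<dots> = (\<Sum>k=1..n. m k)"
    by (simp only: sum.distinct_set_conv_list[OF distinct_upt, symmetric] set_upt atLeastLessThanSuc_atLeastAtMost)
  finally show ?thesis .
qed

lemma mset_dual_shifts: "mset (dual_shifts n m r) = mset (map (\<lambda>a. 1 - a) (shifts n m r))"
proof -
  \<comment> \<open>Replacing \<open>i\<close> by \<open>m k - 1 - i\<close> turns
    \<open>Suc i\<close> into \<open>m k - i\<close>.\<close>
  have rev: "map (\<lambda>i. 1 - real (m k - i) / real (r k)) [0..<m k] =
      rev (map (\<lambda>i. 1 - real (Suc i) / real (r k)) [0..<m k])" for k
    by (rule nth_equalityI) (auto simp: rev_nth)
  show ?thesis
    unfolding dual_shifts_def shifts_def rev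
    by (simp add: mset_concat map_concat comp_def del: upt_Suc)
qed

lemma list_all2_concat_map:
  assumes "\<And>k. k \<in> set xs \<Longrightarrow> list_all2 R (f k) (g k)"
  shows "list_all2 R (concat (map f xs)) (concat (map g xs))"
  using assms by (induction xs) (auto intro: list_all2_appendI)

text \<open>Every entry of block \<open>k\<close> grows by
  \<open>(r k - m k - 1) / r k\<close>.\<close>

lemma shifts_le_dual_shifts:
  assumes "\<forall>k\<in>{1..n}. m k + 1 \<le> r k"
  shows "list_all2 (\<le>) (shifts n m r) (dual_shifts n m r)"
  unfolding shifts_def dual_shifts_def
proof (rule list_all2_concat_map)
  fix k assume "k \<in> set [1..<Suc n]"
  then have r: "m k + 1 \<le> r k"
    using assms by auto
  show "list_all2 (\<le>) (map (\<lambda>i. real (Suc i) / real (r k)) [0..<m k])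
      (map (\<lambda>i. 1 - real (m k - i) / real (r k)) [0..<m k])"
    using r by (intro list_all2_all_nthI) (auto simp: divide_simps of_nat_diff)
qed

lemma shifts_neq_dual_shifts:
  assumes "j \<in> {1..n}" and "1 \<le> m j" and "1 \<le> r j" and "r j \<noteq> m j + 1"
  shows "shifts n m r \<noteq> dual_shifts n m r"
proof
  assume "shifts n m r = dual_shifts n m r"
  then have "map (\<lambda>k. map (\<lambda>i. real (Suc i) / real (r k)) [0..<m k]) [1..<Suc n] =
      map (\<lambda>k. map (\<lambda>i. 1 - real (m k - i) / real (r k)) [0..<m k]) [1..<Suc n]"
    unfolding shifts_def dual_shifts_def
    \<comment> \<open>Corresponding blocks have equal length, so the concatenations agree only if
      the blocks do.\<close>
    by (subst (asm) concat_eq_concat_iff) (auto simp: zip_map_map zip_same_conv_map simp del: upt_Suc)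
  moreover have "j \<in> set [1..<Suc n]"
    using assms(1) by auto
  ultimately have "map (\<lambda>i. real (Suc i) / real (r j)) [0..<m j] =
      map (\<lambda>i. 1 - real (m j - i) / real (r j)) [0..<m j]"
    by (rule bspec[OF map_eq_conv[THEN iffD1]])
  then have "\<forall>i\<in>{0..<m j}. real (Suc i) / real (r j) = 1 - real (m j - i) / real (r j)"
    unfolding map_eq_conv by simp
  from bspec[OF this, of 0] have "1 / real (r j) = 1 - real (m j) / real (r j)"
    using assms(2) by simp
  then have "real (r j) = real (m j) + 1"
    using assms(3) by (simp add: field_simps)
  then show False
    using assms(4) by linarith
qed

lemma set_shifts:
  assumes "\<forall>k\<in>{1..n}. m k + 1 \<le> r k"
  shows "set (shifts n m r) \<subseteq> {0<..<1}"
proof -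
  have "real (Suc i) / real (r k) \<in> {0<..<1}" if "k \<in> {1..n}" "i < m k" for k i
    using assms that by (force simp: divide_simps)
  then show ?thesis
    by (auto simp: shifts_def simp del: upt_Suc)
qed

section \<open>From binomial coefficients to shifts\<close>

lemma prod_list_map_concat:
  "(\<Prod>a\<leftarrow>concat (map g xs). f a) = (\<Prod>x\<leftarrow>xs. \<Prod>a\<leftarrow>g x. f a)"
  by (induction xs) simp_all

lemma prod_shifts:
  "(\<Prod>a\<leftarrow>shifts n m r. t + a) = (\<Prod>k=1..n. \<Prod>i<m k. t + real (Suc i) / real (r k))"
proof -
  have "(\<Prod>a\<leftarrow>map (\<lambda>i. real (Suc i) / real (r k)) [0..<m k]. t + a) =
      (\<Prod>i<m k. t + real (Suc i) / real (r k))" for k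
    unfolding map_map comp_def prod.distinct_set_conv_list[OF distinct_upt, symmetric]
    by (simp add: atLeast0LessThan)
  then show ?thesis
    unfolding shifts_def prod_list_map_concat
    by (simp only: prod.distinct_set_conv_list[OF distinct_upt, symmetric] set_upt
        atLeastLessThanSuc_atLeastAtMost)
qed

text \<open>The binomial coefficient is a rising factorial starting at \<open>r * t + 1\<close>,
  divided by \<open>fact m\<close>; each of its factors yields one \<open>r\<close>.\<close>

lemma binomial_eq_prod:
  assumes "1 \<le> r"
  shows "real ((r * t + m) choose m) = real r ^ m / fact m * (\<Prod>i<m. real t + real (Suc i) / real r)"
proof -
  have "real ((r * t + m) choose m) = pochhammer (real (r * t) + 1) m / fact m"
    unfolding binomial_gbinomial gbinomial_pochhammer' by simp
  also have "pochhammer (real (r * t) + 1) m = (\<Prod>i<m. real r * (real t + real (Suc i) / real r))"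
    unfolding pochhammer_prod atLeast0LessThan using assms
    by (intro prod.cong) (auto simp: field_simps)
  also have "\<dots> = real r ^ m * (\<Prod>i<m. real t + real (Suc i) / real r)"
    by (simp add: prod.distrib)
  finally show ?thesis
    by simp
qed

lemma eulerian_poly_eq_euler:
  assumes "\<forall>k\<in>{1..n}. 1 \<le> r k"
  obtains c where "0 < c" and "eulerian_poly n m r = smult c (euler (shifts n m r))"
proof
  let ?c = "\<Prod>k=1..n. real (r k) ^ m k / fact (m k)"
  show "0 < ?c"
    using assms by (intro prod_pos) force
  have "(\<Prod>k=1..n. real ((r k * t + m k) choose m k)) = ?c * (\<Prod>a\<leftarrow>shifts n m r. real t + a)" for t
    unfolding prod_shifts prod.distrib[symmetric]
    using assms by (intro prod.cong refl binomial_eq_prod) auto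
  then have "Abs_fps (\<lambda>t. \<Prod>k=1..n. real ((r k * t + m k) choose m k)) =
      fps_const ?c * Abs_fps (\<lambda>t. \<Prod>a\<leftarrow>shifts n m r. real t + a)"
    by (intro fps_ext) simp
  then have "fps_of_poly (eulerian_poly n m r) = fps_of_poly (smult ?c (euler (shifts n m r)))"
    unfolding fps_eulerian_poly[OF assms] fps_of_poly_smult fps_euler[symmetric] length_shifts
    by (simp only: mult.assoc)
  then show "eulerian_poly n m r = smult ?c (euler (shifts n m r))"
    by (simp only: fps_of_poly_eq_iff)
qed

lemma reciprocal_smult: "reciprocal d (smult c p) = smult c (reciprocal d p)"
  by (rule poly_eqI) (simp add: coeff_reciprocal)

text \<open>If \<open>r j = m j + 1\<close> for all \<open>j\<close>, the shifts are symmetric under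
  \<open>a\<close> to \<open>1 - a\<close> and the polynomial equals its reciprocal. Strict
  interlacing is then impossible, but the zeros remain simple. One larger \<open>r j\<close> already
  makes all inequalities strict.\<close>

theorem theorem20:
  fixes n :: nat and m r :: "nat \<Rightarrow> nat"
  assumes "n \<ge> 1"
    and "\<forall>j\<in>{1..n}. m j \<ge> 1"
    and "\<forall>j\<in>{1..n}. r j \<ge> 1"
    and "\<forall>j\<in>{1..n}. r j \<ge> m j + 1"
  shows "reciprocal (\<Sum>j=1..n. m j) (eulerian_poly n m r) \<preceq>\<^sub>i eulerian_poly n m r \<and>
         rsquarefree (eulerian_poly n m r) \<and>
         ((\<exists>j\<in>{1..n}. r j \<noteq> m j + 1) \<longrightarrow>
            reciprocal (\<Sum>j=1..n. m j) (eulerian_poly n m r) \<prec>\<^sub>i eulerian_poly n m r)"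
proof -
  let ?A = "eulerian_poly n m r" and ?d = "\<Sum>j=1..n. m j"
  define as where "as = shifts n m r"
  define bs where "bs = dual_shifts n m r"
  have len: "length as = ?d"
    by (simp add: as_def length_shifts)
  have bs: "mset bs = mset (map (\<lambda>a. 1 - a) as)"
    by (simp add: as_def bs_def mset_dual_shifts)
  have le: "list_all2 (\<le>) as bs"
    unfolding as_def bs_def by (rule shifts_le_dual_shifts) (use assms(4) in simp)
  have as01: "set as \<subseteq> {0<..<1}"
    unfolding as_def by (rule set_shifts) (use assms(4) in simp)
  moreover have "set bs = (\<lambda>a. 1 - a) ` set as"
    using bs by (metis set_map set_mset_mset)
  ultimately have bs01: "set bs \<subseteq> {0<..<1}"
    by auto
  have sub: "{0<..<1} \<subseteq> {0<..1 :: real}" and one: "(1 :: real) \<notin> {0<..<1}"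
    by auto
  have deg: "euler_degree as = ?d" "euler_degree bs = ?d"
    using as01 bs01 one len list_all2_lengthD[OF le] by (auto simp: euler_degree_def)
  obtain \<alpha> where \<alpha>: "neg_zeros ?d (euler as) \<alpha>"
    using neg_zeros_euler[of as] as01 sub deg by auto
  obtain \<beta> where \<beta>: "neg_zeros ?d (euler bs) \<beta>"
    using neg_zeros_euler[of bs] bs01 sub deg by auto
  obtain c where c: "0 < c" and A: "?A = smult c (euler as)"
    using eulerian_poly_eq_euler[OF assms(3)] unfolding as_def by blast
  \<comment> \<open>The reciprocal has the shifts \<open>1 - a\<close>; their order is immaterial,
    so the dominating arrangement \<open>bs\<close> may be used.\<close>
  have IA: "reciprocal ?d ?A = smult c (euler bs)"
    unfolding A reciprocal_smult len[symmetric] reciprocal_euler euler_mset_cong[OF bs] ..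
  have A_zeros: "neg_zeros ?d ?A \<alpha>"
    unfolding A by (rule neg_zeros_smult[OF \<alpha> c])
  have IA_zeros: "neg_zeros ?d (reciprocal ?d ?A) \<beta>"
    unfolding IA by (rule neg_zeros_smult[OF \<beta> c])
  have less: "\<beta> i < \<alpha> i" if "as \<noteq> bs" "i < ?d" for i
    using neg_zeros_euler_mono[OF le _ _ that(1) \<alpha> \<beta> that(2)] as01 bs01 sub by blast
  have eq: "\<beta> i = \<alpha> i" if "as = bs" "i < ?d" for i
    using neg_zeros_unique[OF \<beta> _ that(2)] \<alpha> that(1) by simp
  have shifted: "\<alpha> (Suc i) < \<beta> i" if "Suc i < ?d" for i
    using neg_zeros_euler_interlace[OF as01 bs, unfolded len, OF \<alpha> \<beta> that] .
  have alt: "alternating R (zeros_desc ?A) (zeros_desc (reciprocal ?d ?A))"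
    if "\<And>i. i < ?d \<Longrightarrow> R (\<alpha> i) (\<beta> i)" and "\<And>i. Suc i < ?d \<Longrightarrow> R (\<beta> i) (\<alpha> (Suc i))" for R
    unfolding alternating_def zeros_desc_neg_zeros[OF A_zeros] zeros_desc_neg_zeros[OF IA_zeros]
    using that by simp
  have weak: "reciprocal ?d ?A \<preceq>\<^sub>i ?A"
    unfolding interlaces_def
  proof (intro conjI alt)
    show "\<beta> i \<le> \<alpha> i" if "i < ?d" for i
      using less[OF _ that] eq[OF _ that] by (cases "as = bs") auto
  qed (use real_rooted_neg_zeros[OF A_zeros] real_rooted_neg_zeros[OF IA_zeros] shifted in \<open>auto intro: less_imp_le\<close>)
  have strict: "reciprocal ?d ?A \<prec>\<^sub>i ?A" if "\<exists>j\<in>{1..n}. r j \<noteq> m j + 1"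
  proof -
    have "as \<noteq> bs"
      using that shifts_neq_dual_shifts[of _ n m r] assms(2,3) unfolding as_def bs_def by blast
    then show ?thesis
      unfolding strictly_interlaces_def
      using real_rooted_neg_zeros[OF A_zeros] real_rooted_neg_zeros[OF IA_zeros] less shifted
      by (intro conjI alt) auto
  qed
  show ?thesis
    using weak strict rsquarefree_neg_zeros[OF A_zeros] by blast
qed

end
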